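(* For every integer $n>1$, \[ CP_{(1,1)}(n,X,Y)=\frac{1-X_{n-1}X_{n}Y_{n-1}Y_{n}}{(1-X_{n}Y_{n-1})(1-X_{n-1}Y_{n})(1-X_{n}Y_{n})}\, CP_{(1,1)}(n-1,X,Y). \]
   Context: Let $x_1,x_2,\dots,y_1,y_2,\dots$ be formal variables, $X_i:=x_1x_2\cdots x_i$, $Y_i:=y_1\cdots y_i$. For $n\ge1$, $CP_{(1,1)}(n,X,Y):=\sum \prod_{i=1}^n x_i^{a_i}y_i^{b_i}$, the sum over all tuples of nonnegative integers $(a_1,\dots,a_n,b_1,\dots,b_n)$ with $a_1\ge a_2\ge\dots\ge a_n$, $b_1\ge\dots\ge b_n$, $a_j\ge b_{j+1}$ and $b_j\ge a_{j+1}$ for all $j\ge1$, where $a_j=b_j=0$ for $j>n$. (These are the cylindric partitions with profile $(1,1)$ whose two rows $(a_j)$, $(b_j)$ have at most $n$ nonzero entries.) *)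

theory Defs
  imports Main "HOL-Library.Poly_Mapping"
begin

text \<open>
  Formal power series over \<open>'a\<close> in an arbitrary (possibly infinite) family of commuting
  variables indexed by \<open>'v\<close>. A monomial is its finitely supported exponent map, so a power
  series is an arbitrary function from \<open>'v \<Rightarrow>\<^sub>0 nat\<close> to the coefficients.
\<close>

typedef ('v, 'a) mfps = "UNIV :: (('v \<Rightarrow>\<^sub>0 nat) \<Rightarrow> 'a) set"
  morphisms mcoeff Abs_mfps
  by simp

lemma mcoeff_Abs [simp]: "mcoeff (Abs_mfps f) = f"
  by (simp add: Abs_mfps_inverse)

lemma mfps_eqI: "(\<And>m. mcoeff f m = mcoeff g m) \<Longrightarrow> f = g"
  by (metis ext mcoeff_inject)

lemma finite_monom_divisors: "finite {p :: 'v \<Rightarrow>\<^sub>0 nat. \<exists>q. p + q = m}"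
proof -
  let ?S = "{p :: 'v \<Rightarrow>\<^sub>0 nat. \<exists>q. p + q = m}"
  let ?K = "Poly_Mapping.keys m"
  let ?B = "\<Union>v\<in>?K. {..Poly_Mapping.lookup m v :: nat}"
  let ?F = "{f. \<forall>v. (v \<in> ?K \<longrightarrow> f v \<in> ?B) \<and> (v \<notin> ?K \<longrightarrow> f v = 0)}"
  have "Poly_Mapping.lookup p \<in> ?F" if "p + q = m" for p q
  proof -
    have "Poly_Mapping.lookup p v \<le> Poly_Mapping.lookup m v" for v
      using that by (auto simp: lookup_add)
    then show ?thesis
      by (auto simp: in_keys_iff) (metis in_keys_iff less_irrefl, metis le_zero_eq)
  qed
  then have "Poly_Mapping.lookup ` ?S \<subseteq> ?F"
    by (intro image_subsetI) (elim CollectE exE)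
  moreover have "finite ?F"
    by (rule finite_set_of_finite_funs) auto
  ultimately have "finite (Poly_Mapping.lookup ` ?S)"
    by (rule finite_subset)
  moreover have "inj_on Poly_Mapping.lookup ?S"
    by (auto intro!: inj_onI poly_mapping_eqI)
  ultimately show ?thesis
    by (rule finite_imageD)
qed

lemma finite_monom_splits [simp]: "finite {(p, q). p + q = (m :: 'v \<Rightarrow>\<^sub>0 nat)}"
proof -
  let ?S = "{p :: 'v \<Rightarrow>\<^sub>0 nat. \<exists>q. p + q = m}"
  have "{(p, q). p + q = m} \<subseteq> ?S \<times> ?S"
    by (auto) (metis add.commute)
  then show ?thesis
    using finite_monom_divisors finite_subset by blast
qed

instantiation mfps :: (type, zero) zero
begin
definition "0 = Abs_mfps (\<lambda>m. 0)"
instance ..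
end

instantiation mfps :: (type, zero_neq_one) one
begin
definition "1 = Abs_mfps (\<lambda>m. if m = 0 then 1 else 0)"
instance ..
end

instantiation mfps :: (type, plus) plus
begin
definition "f + g = Abs_mfps (\<lambda>m. mcoeff f m + mcoeff g m)"
instance ..
end

instantiation mfps :: (type, minus) minus
begin
definition "f - g = Abs_mfps (\<lambda>m. mcoeff f m - mcoeff g m)"
instance ..
end

instantiation mfps :: (type, uminus) uminus
begin
definition "- f = Abs_mfps (\<lambda>m. - mcoeff f m)"
instance ..
end

instantiation mfps :: (type, "{comm_monoid_add, times}") times
begin
definition "f * g = Abs_mfps (\<lambda>m. \<Sum>(p, q) | p + q = m. mcoeff f p * mcoeff g q)"
instance ..
end

lemma mcoeff_zero [simp]: "mcoeff 0 m = 0"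
  and mcoeff_one: "mcoeff 1 m = (if m = 0 then 1 else 0)"
  and mcoeff_add [simp]: "mcoeff (f + g) m = mcoeff f m + mcoeff g m"
  and mcoeff_diff [simp]: "mcoeff (f' - g') m = mcoeff f' m - mcoeff g' m"
  and mcoeff_uminus [simp]: "mcoeff (- h) m = - mcoeff h m"
  by (simp_all add: zero_mfps_def one_mfps_def plus_mfps_def minus_mfps_def uminus_mfps_def)

lemma mcoeff_mult:
  "mcoeff (f * g) m = (\<Sum>(p, q) | p + q = m. mcoeff f p * mcoeff g q)"
  by (simp add: times_mfps_def)

instance mfps :: (type, comm_ring_1) comm_ring_1
proof
  fix f g h :: "('a, 'b) mfps"
  show "f + g + h = f + (g + h)" "f + g = g + f" "0 + f = f" "- f + f = 0" "f - g = f + - g"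
    by (rule mfps_eqI, simp add: add_ac)+
  show "f * g = g * f"
  proof (rule mfps_eqI)
    fix m
    show "mcoeff (f * g) m = mcoeff (g * f) m"
      unfolding mcoeff_mult
      by (rule sum.reindex_bij_witness[of _ "\<lambda>(p, q). (q, p)" "\<lambda>(p, q). (q, p)"])
         (auto simp: ac_simps)
  qed
  show "1 * f = f"
  proof (rule mfps_eqI)
    fix m
    have "mcoeff (1 * f) m = (\<Sum>(p, q) \<in> {(0, m)}. mcoeff (1 :: ('a, 'b) mfps) p * mcoeff f q)"
      unfolding mcoeff_mult by (rule sum.mono_neutral_right) (auto simp: mcoeff_one split: if_splits)
    then show "mcoeff (1 * f) m = mcoeff f m"
      by (simp add: mcoeff_one)
  qed
  show "(f + g) * h = f * h + g * h"
    by (rule mfps_eqI)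
       (simp add: mcoeff_mult sum.distrib[symmetric] case_prod_unfold algebra_simps)
  show "(0 :: ('a, 'b) mfps) \<noteq> 1"
    by (metis mcoeff_one mcoeff_zero zero_neq_one)
  show "f * g * h = f * (g * h)"
  proof (rule mfps_eqI)
    fix m
    let ?D = "\<lambda>m :: 'a \<Rightarrow>\<^sub>0 nat. {(p, q). p + q = m}"
    have "mcoeff (f * g * h) m =
        (\<Sum>u\<in>?D m. \<Sum>v\<in>?D (fst u). mcoeff f (fst v) * mcoeff g (snd v) * mcoeff h (snd u))"
      by (simp add: mcoeff_mult case_prod_unfold sum_distrib_right)
    also have "\<dots> = (\<Sum>(u, v)\<in>(SIGMA u:?D m. ?D (fst u)).
        mcoeff f (fst v) * mcoeff g (snd v) * mcoeff h (snd u))"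
      by (rule sum.Sigma) (use finite_monom_splits in blast)+
    also have "\<dots> = (\<Sum>(u, v)\<in>(SIGMA u:?D m. ?D (snd u)).
        mcoeff f (fst u) * (mcoeff g (fst v) * mcoeff h (snd v)))"
      by (rule sum.reindex_bij_witness
            [of _ "\<lambda>((p, s), (q, r)). ((p + q, r), (p, q))" "\<lambda>((s, r), (p, q)). ((p, q + r), (q, r))"])
         (auto simp: ac_simps)
    also have "\<dots> =
        (\<Sum>u\<in>?D m. \<Sum>v\<in>?D (snd u). mcoeff f (fst u) * (mcoeff g (fst v) * mcoeff h (snd v)))"
      by (rule sum.Sigma[symmetric]) (use finite_monom_splits in blast)+
    also have "\<dots> = mcoeff (f * (g * h)) m"
      by (simp add: mcoeff_mult case_prod_unfold sum_distrib_left)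
    finally show "mcoeff (f * g * h) m = mcoeff (f * (g * h)) m" .
  qed
qed

text \<open>
  The inverse is the genuine one on units and \<open>0\<close> elsewhere; \<open>mfps_inverse_one_minus\<close> below
  shows that every \<open>1 - f\<close> with \<open>f\<close> free of constant term is a unit.
\<close>

instantiation mfps :: (type, comm_ring_1) inverse
begin
definition
  "inverse f = (if \<exists>g. f * g = 1 then THE g. f * g = 1 else (0 :: ('a, 'b) mfps))"
definition
  "f div g = f * inverse (g :: ('a, 'b) mfps)"
instance ..
end

lemma mfps_inverse_unique:
  fixes f g :: "('v, 'a :: comm_ring_1) mfps"
  assumes "f * g = 1"
  shows "inverse f = g"
proof -
  have "h = g" if "f * h = 1" for h
  proof -
    have "h = (f * g) * h"
      by (simp add: assms)
    also have "\<dots> = (f * h) * g"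
      by (simp only: mult_ac)
    finally show ?thesis
      by (simp add: that)
  qed
  with assms have "(THE g. f * g = 1) = g"
    by (rule the_equality)
  moreover have "\<exists>g. f * g = 1"
    using assms by blast
  ultimately show ?thesis
    by (simp add: inverse_mfps_def)
qed

definition mdeg :: "('v \<Rightarrow>\<^sub>0 nat) \<Rightarrow> nat" where
  "mdeg m = sum (Poly_Mapping.lookup m) (Poly_Mapping.keys m)"

lemma mdeg_add: "mdeg (p + q) = mdeg p + mdeg q"
proof -
  let ?K = "Poly_Mapping.keys p \<union> Poly_Mapping.keys q"
  have "mdeg r = sum (Poly_Mapping.lookup r) ?K" if "Poly_Mapping.keys r \<subseteq> ?K" for r
    unfolding mdeg_def by (rule sum.mono_neutral_left) (use that in \<open>auto simp: in_keys_iff\<close>)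
  moreover have "Poly_Mapping.keys (p + q) \<subseteq> ?K"
    by (rule Poly_Mapping.keys_add)
  ultimately show ?thesis
    by (simp add: lookup_add sum.distrib)
qed

lemma mdeg_eq_0: "mdeg m = 0 \<longleftrightarrow> m = 0"
  by (auto simp: mdeg_def in_keys_iff intro!: poly_mapping_eqI)

lemma mcoeff_power_eq_0:
  fixes f :: "('v, 'a :: comm_ring_1) mfps"
  assumes "mcoeff f 0 = 0" "mdeg m < k"
  shows "mcoeff (f ^ k) m = 0"
  using assms(2)
proof (induction k arbitrary: m)
  case (Suc k)
  have "mcoeff f p * mcoeff (f ^ k) q = 0" if "p + q = m" for p q
  proof (cases "p = 0")
    case False
    then have "mdeg p > 0"
      using mdeg_eq_0[of p] by simp
    then have "mdeg q < k"
      using Suc.prems that mdeg_add[of p q] by simp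
    then show ?thesis
      by (simp add: Suc.IH)
  qed (simp add: assms)
  then show ?case
    by (auto simp: mcoeff_mult intro!: sum.neutral)
qed simp

lemma mcoeff_sum: "mcoeff (\<Sum>i\<in>I. f i) m = (\<Sum>i\<in>I. mcoeff (f i :: ('v, 'a :: comm_ring_1) mfps) m)"
  by (induction I rule: infinite_finite_induct) auto

lemma mfps_inverse_one_minus:
  fixes f :: "('v, 'a :: comm_ring_1) mfps"
  assumes "mcoeff f 0 = 0"
  shows "(1 - f) * inverse (1 - f) = 1"
proof -
  define g where "g = Abs_mfps (\<lambda>m. \<Sum>k\<le>mdeg m. mcoeff (f ^ k) m)"
  have g: "mcoeff g q = mcoeff (\<Sum>k\<le>N. f ^ k) q" if "mdeg q \<le> N" for q N
    unfolding g_def mcoeff_sum mcoeff_Abs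
    by (rule sum.mono_neutral_left) (use that assms in \<open>auto intro!: mcoeff_power_eq_0\<close>)
  have "(1 - f) * g = 1"
  proof (rule mfps_eqI)
    fix m
    have "mcoeff ((1 - f) * g) m = mcoeff ((1 - f) * (\<Sum>k\<le>mdeg m. f ^ k)) m"
      unfolding mcoeff_mult by (rule sum.cong) (auto simp: mdeg_add intro!: arg_cong2[where f = "(*)"] g)
    also have "(1 - f) * (\<Sum>k\<le>mdeg m. f ^ k) = 1 - f ^ Suc (mdeg m)"
      by (simp only: sum_gp_basic)
    also have "mcoeff \<dots> m = mcoeff 1 m"
      using mcoeff_power_eq_0[OF assms, of m "Suc (mdeg m)"] by (simp del: power_Suc)
    finally show "mcoeff ((1 - f) * g) m = mcoeff 1 m" .
  qed
  then show ?thesis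
    using mfps_inverse_unique by metis
qed

definition mfps_var :: "'v \<Rightarrow> ('v, 'a :: comm_ring_1) mfps" where
  "mfps_var v = Abs_mfps (\<lambda>m. if m = Poly_Mapping.single v 1 then 1 else 0)"

text \<open>
  The formal (coefficientwise) sum of a possibly infinite family; it is meaningful when each
  monomial has a nonzero coefficient in only finitely many members.
\<close>

definition mfps_summable :: "('i \<Rightarrow> ('v, 'a :: comm_ring_1) mfps) \<Rightarrow> 'i set \<Rightarrow> bool" where
  "mfps_summable f I \<longleftrightarrow> (\<forall>m. finite {i \<in> I. mcoeff (f i) m \<noteq> 0})"

definition mfps_suminf :: "('i \<Rightarrow> ('v, 'a :: comm_ring_1) mfps) \<Rightarrow> 'i set \<Rightarrow> ('v, 'a) mfps" where
  "mfps_suminf f I = Abs_mfps (\<lambda>m. \<Sum>i | i \<in> I \<and> mcoeff (f i) m \<noteq> 0. mcoeff (f i) m)"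

text \<open>
  The variables \<open>x i\<close> and \<open>y i\<close> are used for \<open>i \<ge> 1\<close> only; the spare
  index \<open>0\<close> never occurs.
\<close>

definition xvar :: "nat \<Rightarrow> (nat + nat, 'a :: comm_ring_1) mfps" where
  "xvar i = mfps_var (Inl i)"

definition yvar :: "nat \<Rightarrow> (nat + nat, 'a :: comm_ring_1) mfps" where
  "yvar i = mfps_var (Inr i)"

definition Xprod :: "nat \<Rightarrow> (nat + nat, 'a :: comm_ring_1) mfps" where
  "Xprod n = (\<Prod>i=1..n. xvar i)"

definition Yprod :: "nat \<Rightarrow> (nat + nat, 'a :: comm_ring_1) mfps" where
  "Yprod n = (\<Prod>i=1..n. yvar i)"

text \<open>
  A tuple \<open>(a\<^sub>1, \<dots>, a\<^sub>n)\<close> is a function on all of \<open>nat\<close>, zero outside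
  \<open>{1..n}\<close>; fixing the value at the unused index \<open>0\<close> makes the correspondence bijective.
\<close>

definition cylindric11 :: "nat \<Rightarrow> ((nat \<Rightarrow> nat) \<times> (nat \<Rightarrow> nat)) set" where
  "cylindric11 n = {(a, b).
     (\<forall>j. j \<notin> {1..n} \<longrightarrow> a j = 0 \<and> b j = 0) \<and>
     (\<forall>j\<ge>1. a j \<ge> a (j + 1) \<and> b j \<ge> b (j + 1) \<and> a j \<ge> b (j + 1) \<and> b j \<ge> a (j + 1))}"

definition CP11 :: "nat \<Rightarrow> (nat + nat, 'a :: comm_ring_1) mfps" where
  "CP11 n = mfps_suminf (\<lambda>(a, b). \<Prod>i=1..n. xvar i ^ a i * yvar i ^ b i) (cylindric11 n)"

definition mfps_monom :: "('v \<Rightarrow>\<^sub>0 nat) \<Rightarrow> ('v, 'a :: comm_ring_1) mfps" where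
  "mfps_monom k = Abs_mfps (\<lambda>m. if m = k then 1 else 0)"

lemma mfps_monom_0: "mfps_monom 0 = 1"
  by (simp add: mfps_monom_def one_mfps_def)

lemma mfps_monom_mult: "mfps_monom k * mfps_monom l = mfps_monom (k + l)"
proof (rule mfps_eqI)
  fix m
  have "mcoeff (mfps_monom k * mfps_monom l) m =
      (\<Sum>u | fst u + snd u = m. if u = (k, l) then 1 else 0 :: 'b)"
    unfolding mcoeff_mult by (rule sum.cong) (auto simp: mfps_monom_def split: if_splits)
  also have "\<dots> = (if k + l = m then 1 else 0)"
    using finite_monom_splits[of m] by (subst sum.delta) (auto simp: case_prod_unfold)
  finally show "mcoeff (mfps_monom k * mfps_monom l) m = mcoeff (mfps_monom (k + l) :: ('a, 'b) mfps) m"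
    by (auto simp: mfps_monom_def)
qed

lemma mfps_var_power: "mfps_var v ^ k = mfps_monom (Poly_Mapping.single v k)"
  by (induction k)
     (simp_all add: mfps_monom_0 mfps_var_def mfps_monom_def[symmetric] mfps_monom_mult
        single_add[symmetric])

lemma mfps_monom_prod: "(\<Prod>i\<in>I. mfps_monom (k i)) = mfps_monom (\<Sum>i\<in>I. k i)"
  by (induction I rule: infinite_finite_induct) (simp_all add: mfps_monom_0 mfps_monom_mult)

lemma CP11_summable:
  "mfps_summable (\<lambda>(a, b). \<Prod>i=1..n. xvar i ^ a i * yvar i ^ b i :: (nat + nat, 'a :: comm_ring_1) mfps)
     (cylindric11 n)"
  unfolding mfps_summable_def
proof
  fix m :: "nat + nat \<Rightarrow>\<^sub>0 nat"
  let ?f = "\<lambda>(a, b). \<Prod>i=1..n. xvar i ^ a i * yvar i ^ b i :: (nat + nat, 'a) mfps"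
  let ?e = "\<lambda>a b. \<Sum>i=1..n. Poly_Mapping.single (Inl i :: nat + nat) (a i :: nat) + Poly_Mapping.single (Inr i) (b i)"
  let ?w = "(\<lambda>j. if j \<in> {1..n} then Poly_Mapping.lookup m (Inl j) else 0,
             \<lambda>j. if j \<in> {1..n} then Poly_Mapping.lookup m (Inr j) else 0)"
  have "u = ?w" if u: "u \<in> cylindric11 n" "mcoeff (?f u) m \<noteq> 0" for u
  proof -
    obtain a b where ab: "u = (a, b)"
      by (cases u)
    have "?f u = mfps_monom (?e a b)"
      by (simp add: ab xvar_def yvar_def mfps_var_power mfps_monom_mult mfps_monom_prod)
    with u have m: "m = ?e a b"
      by (auto simp: mfps_monom_def split: if_splits)
    have "Poly_Mapping.lookup m (Inl j) = a j" "Poly_Mapping.lookup m (Inr j) = b j" if "j \<in> {1..n}" for j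
      using that by (auto simp: m lookup_sum lookup_add lookup_single when_def)
    moreover have "a j = 0" "b j = 0" if "j \<notin> {1..n}" for j
      using u that by (auto simp: ab cylindric11_def)
    ultimately show ?thesis
      by (auto simp: ab fun_eq_iff)
  qed
  then have "{u \<in> cylindric11 n. mcoeff (?f u) m \<noteq> 0} \<subseteq> {?w}"
    by blast
  then show "finite {u \<in> cylindric11 n. mcoeff (?f u) m \<noteq> 0}"
    by (rule finite_subset) simp
qed

end

theory Submission
  imports Defs
begin

text \<open>
  Identify a cylindric partition with the exponent of its monomial, and let \<open>U i j\<close> be the set of
  exponents of those partitions whose rows have at most \<open>i\<close> and \<open>j\<close> nonzero entries. If \<open>i\<close> and
  \<open>j\<close> differ by at most one, then \<open>U i j\<close> is stable under adding the exponent of \<open>X\<^sub>i Y\<^sub>j\<close>, so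
  multiplying its generating function by \<open>1 - X\<^sub>i Y\<^sub>j\<close> leaves only the partitions from which this
  exponent cannot be removed. For \<open>U n n\<close> these form \<open>U n (n-1) \<union> U (n-1) n\<close>, a union
  with intersection \<open>U (n-1) (n-1)\<close>; for \<open>U n (n-1)\<close> and \<open>U (n-1) n\<close> they form \<open>U (n-1) (n-1)\<close>.
  Eliminating the two mixed generating functions gives the recurrence.
\<close>

section \<open>Generating functions of sets of exponents\<close>

definition mfps_indicator :: "('v \<Rightarrow>\<^sub>0 nat) set \<Rightarrow> ('v, 'a :: comm_ring_1) mfps" where
  "mfps_indicator S = Abs_mfps (\<lambda>m. if m \<in> S then 1 else 0)"

lemma mcoeff_indicator: "mcoeff (mfps_indicator S) m = (if m \<in> S then 1 else 0)"
  by (simp add: mfps_indicator_def)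

lemma mfps_indicator_Un_Int:
  "mfps_indicator (S \<union> T) + mfps_indicator (S \<inter> T) = mfps_indicator S + mfps_indicator T"
  by (rule mfps_eqI) (simp add: mcoeff_indicator)

lemma mfps_monom_mult_indicator:
  "mfps_monom k * mfps_indicator S = mfps_indicator ((+) k ` S)"
proof (rule mfps_eqI)
  fix m
  let ?c = "\<lambda>u. mcoeff (mfps_monom k) (fst u) * mcoeff (mfps_indicator S) (snd u) :: 'b"
  have "mcoeff (mfps_monom k * mfps_indicator S) m = (\<Sum>u \<in> {(p, q). p + q = m}. ?c u)"
    by (simp add: mcoeff_mult case_prod_unfold)
  \<comment> \<open>Only splittings with first part \<open>k\<close> contribute, and cancellation of
    exponents leaves at most one of them.\<close>
  also have "\<dots> = (\<Sum>u \<in> {u. fst u = k \<and> k + snd u = m \<and> snd u \<in> S}. ?c u)"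
    by (rule sum.mono_neutral_right)
       (auto simp: mfps_monom_def mcoeff_indicator split: if_splits)
  also have "\<dots> = (if m \<in> (+) k ` S then 1 else 0)"
  proof (cases "m \<in> (+) k ` S")
    case True
    then obtain q where q: "m = k + q" "q \<in> S"
      by auto
    then have "{u. fst u = k \<and> k + snd u = m \<and> snd u \<in> S} = {(k, q)}"
      by auto
    with q show ?thesis
      by (simp add: mfps_monom_def mcoeff_indicator)
  next
    case False
    then have "{u. fst u = k \<and> k + snd u = m \<and> snd u \<in> S} = {}"
      by auto
    with False show ?thesis
      by (simp only: sum.empty if_False)
  qed
  finally show "mcoeff (mfps_monom k * mfps_indicator S) m =
      mcoeff (mfps_indicator ((+) k ` S) :: ('a, 'b) mfps) m"
    by (simp add: mcoeff_indicator)
qed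

text \<open>Stability under the shift puts the subtracted set inside \<open>S\<close>, so no
  coefficient -1 arises and the difference is again an indicator.\<close>

lemma one_minus_monom_mult_indicator:
  assumes "(+) k ` S \<subseteq> S"
  shows "(1 - mfps_monom k) * mfps_indicator S = mfps_indicator (S - (+) k ` S)"
proof -
  have "(1 - mfps_monom k) * mfps_indicator S =
      mfps_indicator S - (mfps_indicator ((+) k ` S) :: ('a, 'b) mfps)"
    by (simp add: left_diff_distrib mfps_monom_mult_indicator)
  also have "\<dots> = mfps_indicator (S - (+) k ` S)"
    by (rule mfps_eqI) (use assms in \<open>auto simp: mcoeff_indicator\<close>)
  finally show ?thesis .
qed

section \<open>Division by units\<close>

lemma mfps_divide_eqI:
  fixes d r :: "('v, 'a :: comm_ring_1) mfps"
  assumes "d * inverse d = 1" "d * f = r * g"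
  shows "f = r / d * g"
proof -
  \<comment> \<open>\<open>inverse\<close> is genuine only on units, so cancelling \<open>d\<close>
    rests on the first assumption.\<close>
  have "f = inverse d * (d * f)"
    using assms(1) by (metis mult.assoc mult.commute mult_1)
  then show ?thesis
    by (simp add: assms(2) divide_mfps_def mult_ac)
qed

lemma mfps_mult_inverse:
  fixes f g :: "('v, 'a :: comm_ring_1) mfps"
  assumes "f * inverse f = 1" "g * inverse g = 1"
  shows "(f * g) * inverse (f * g) = 1"
proof -
  have "(f * g) * (inverse f * inverse g) = (f * inverse f) * (g * inverse g)"
    by (simp only: mult_ac)
  then have "(f * g) * (inverse f * inverse g) = 1"
    by (simp add: assms)
  then show ?thesis
    using mfps_inverse_unique by metis
qed

lemma mfps_inverse_one_minus_monom:
  assumes "k \<noteq> 0"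
  shows "(1 - mfps_monom k) * inverse (1 - mfps_monom k :: ('v, 'a :: comm_ring_1) mfps) = 1"
  using assms by (intro mfps_inverse_one_minus) (simp add: mfps_monom_def)

section \<open>Exponents of the monomials X_i Y_j\<close>

definition xy_exponent :: "nat \<Rightarrow> nat \<Rightarrow> nat + nat \<Rightarrow>\<^sub>0 nat" where
  "xy_exponent i j =
     (\<Sum>l=1..i. Poly_Mapping.single (Inl l) 1) + (\<Sum>l=1..j. Poly_Mapping.single (Inr l) 1)"

lemma lookup_xy_exponent [simp]:
  "Poly_Mapping.lookup (xy_exponent i j) (Inl l) = of_bool (l \<in> {1..i})"
  "Poly_Mapping.lookup (xy_exponent i j) (Inr l) = of_bool (l \<in> {1..j})"
  by (auto simp: xy_exponent_def lookup_add lookup_sum lookup_single when_def)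

lemma xy_exponent_nonzero:
  assumes "i > 0 \<or> j > 0"
  shows "xy_exponent i j \<noteq> 0"
proof
  assume "xy_exponent i j = 0"
  then have "of_bool (1 \<in> {1..i}) = (0 :: nat)" "of_bool (1 \<in> {1..j}) = (0 :: nat)"
    by (metis lookup_xy_exponent lookup_zero)+
  with assms show False
    by (auto split: if_splits)
qed

lemma Xprod_mult_Yprod: "Xprod i * Yprod j = mfps_monom (xy_exponent i j)"
proof -
  have var: "mfps_var v = mfps_monom (Poly_Mapping.single v 1)" for v :: "nat + nat"
    using mfps_var_power[of v 1] by simp
  show ?thesis
    by (simp add: Xprod_def Yprod_def xvar_def yvar_def var mfps_monom_prod mfps_monom_mult
        xy_exponent_def)
qed

section \<open>Interlacing rows and the sets U i j\<close>

definition interlacing :: "(nat \<Rightarrow> nat) \<Rightarrow> (nat \<Rightarrow> nat) \<Rightarrow> bool" where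
  "interlacing a b \<longleftrightarrow>
     (\<forall>l\<ge>1. a l \<ge> a (l + 1) \<and> b l \<ge> b (l + 1) \<and> a l \<ge> b (l + 1) \<and> b l \<ge> a (l + 1))"

lemma interlacing_antimono:
  assumes "interlacing a b" "1 \<le> l" "l \<le> n"
  shows "a n \<le> a l" "b n \<le> b l"
proof -
  from assms(3) have "a n \<le> a l \<and> b n \<le> b l"
  proof (induction n rule: dec_induct)
    case (step n)
    then have "a (n + 1) \<le> a n" "b (n + 1) \<le> b n"
      using assms(1,2) by (simp_all add: interlacing_def)
    with step.IH show ?case
      by simp
  qed simp
  then show "a n \<le> a l" "b n \<le> b l"
    by simp_all
qed

text \<open>One cross inequality leads from \<open>l\<close> to \<open>l + 1\<close>, then each row
  descends on its own. Entries of the two rows with equal index may be ordered either way, hence the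
  strict \<open>l < n\<close>.\<close>

lemma interlacing_antimono_strict:
  assumes "interlacing a b" "1 \<le> l" "l < n"
  shows "a n \<le> b l" "b n \<le> a l"
proof -
  have "a (l + 1) \<le> b l" "b (l + 1) \<le> a l"
    using assms(1,2) by (simp_all add: interlacing_def)
  moreover have "a n \<le> a (l + 1)" "b n \<le> b (l + 1)"
    using interlacing_antimono[OF assms(1), of "l + 1" n] assms(3) by simp_all
  ultimately show "a n \<le> b l" "b n \<le> a l"
    by simp_all
qed

text \<open>Working with exponents instead of pairs of rows turns multiplication by X_i Y_j into a
  translation; separate bounds admit the mixed cases. Index 0 lies outside both ranges and is forced
  to carry 0.\<close>

definition cylindric_exponents :: "nat \<Rightarrow> nat \<Rightarrow> (nat + nat \<Rightarrow>\<^sub>0 nat) set" where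
  "cylindric_exponents i j = {m.
     (\<forall>l. l \<notin> {1..i} \<longrightarrow> Poly_Mapping.lookup m (Inl l) = 0) \<and>
     (\<forall>l. l \<notin> {1..j} \<longrightarrow> Poly_Mapping.lookup m (Inr l) = 0) \<and>
     interlacing (\<lambda>l. Poly_Mapping.lookup m (Inl l)) (\<lambda>l. Poly_Mapping.lookup m (Inr l))}"

text \<open>An inequality could fail only if its smaller side is raised and its larger side is not.
  Within a row the raised entries form an initial segment; across rows this would need i > j + 1 or
  j > i + 1.\<close>

lemma xy_exponent_add_cylindric:
  assumes "m \<in> cylindric_exponents i j" "i \<le> j + 1" "j \<le> i + 1"
  shows "xy_exponent i j + m \<in> cylindric_exponents i j"
  using assms by (auto simp: cylindric_exponents_def interlacing_def lookup_add)

lemma cylindric_diff_xy_exponent: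
  assumes "m \<in> cylindric_exponents i j" "i \<le> j + 1" "j \<le> i + 1"
    and "\<And>l. l \<in> {1..i} \<Longrightarrow> Poly_Mapping.lookup m (Inl l) > 0"
    and "\<And>l. l \<in> {1..j} \<Longrightarrow> Poly_Mapping.lookup m (Inr l) > 0"
  shows "m \<in> (+) (xy_exponent i j) ` cylindric_exponents i j"
proof
  \<comment> \<open>Subtraction of exponents is truncated, so adding the shift back needs the
    lowered entries to be positive.\<close>
  show "m = xy_exponent i j + (m - xy_exponent i j)"
  proof (rule poly_mapping_eqI)
    fix v
    show "Poly_Mapping.lookup m v = Poly_Mapping.lookup (xy_exponent i j + (m - xy_exponent i j)) v"
      using assms(4,5) by (cases v) (force simp: lookup_add lookup_minus)+
  qed
  \<comment> \<open>If only the larger side of an inequality is lowered, the smaller side lies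
    outside the support and is 0.\<close>
  show "m - xy_exponent i j \<in> cylindric_exponents i j"
    using assms(1-3)
    by (auto simp: cylindric_exponents_def interlacing_def lookup_minus diff_le_mono)
qed

lemma cylindric_exponents_less:
  assumes "n > 0"
  shows "cylindric_exponents (n - 1) j =
      {m \<in> cylindric_exponents n j. Poly_Mapping.lookup m (Inl n) = 0}"
    and "cylindric_exponents i (n - 1) =
      {m \<in> cylindric_exponents i n. Poly_Mapping.lookup m (Inr n) = 0}"
proof -
  have *: "(\<forall>l. l \<notin> {1..n - 1} \<longrightarrow> f l = 0) \<longleftrightarrow> (\<forall>l. l \<notin> {1..n} \<longrightarrow> f l = 0) \<and> f n = 0"
    for f :: "nat \<Rightarrow> nat"
  proof -
    have "l \<notin> {1..n - 1} \<longleftrightarrow> l \<notin> {1..n} \<or> l = n" for l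
      using assms by auto
    then show ?thesis
      by blast
  qed
  show "cylindric_exponents (n - 1) j =
      {m \<in> cylindric_exponents n j. Poly_Mapping.lookup m (Inl n) = 0}"
    unfolding cylindric_exponents_def * by auto
  show "cylindric_exponents i (n - 1) =
      {m \<in> cylindric_exponents i n. Poly_Mapping.lookup m (Inr n) = 0}"
    unfolding cylindric_exponents_def * by auto
qed

text \<open>The shift can be removed iff all entries it lowers are positive, and the last entries
  decide this. For equal lengths both rows matter, and a_n = 0 or b_n = 0 yields the union. In a
  mixed case the shorter row stops at n - 1, so its entries there dominate the n-th entry of the
  longer row, which alone decides.\<close>

lemma cylindric_exponents_unshifted:
  assumes "n > 0"
  shows "cylindric_exponents n n - (+) (xy_exponent n n) ` cylindric_exponents n n =
      cylindric_exponents n (n - 1) \<union> cylindric_exponents (n - 1) n" (is ?both)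
    and "cylindric_exponents n (n - 1) - (+) (xy_exponent n (n - 1)) ` cylindric_exponents n (n - 1) =
      cylindric_exponents (n - 1) (n - 1)" (is ?left)
    and "cylindric_exponents (n - 1) n - (+) (xy_exponent (n - 1) n) ` cylindric_exponents (n - 1) n =
      cylindric_exponents (n - 1) (n - 1)" (is ?right)
proof -
  have anti: "Poly_Mapping.lookup m (Inl n) \<le> Poly_Mapping.lookup m (Inl l)"
      "Poly_Mapping.lookup m (Inr n) \<le> Poly_Mapping.lookup m (Inr l)"
    if "m \<in> cylindric_exponents i j" "l \<in> {1..n}" for m i j l
    using interlacing_antimono[of _ _ l n] that by (auto simp: cylindric_exponents_def)
  have strict: "Poly_Mapping.lookup m (Inl n) \<le> Poly_Mapping.lookup m (Inr l)"
      "Poly_Mapping.lookup m (Inr n) \<le> Poly_Mapping.lookup m (Inl l)"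
    if "m \<in> cylindric_exponents i j" "l \<in> {1..n - 1}" for m i j l
  proof -
    have "l < n"
      using that(2) assms by auto
    then show "Poly_Mapping.lookup m (Inl n) \<le> Poly_Mapping.lookup m (Inr l)"
        "Poly_Mapping.lookup m (Inr n) \<le> Poly_Mapping.lookup m (Inl l)"
      using interlacing_antimono_strict[of _ _ l n] that by (auto simp: cylindric_exponents_def)
  qed
  note less = cylindric_exponents_less[OF assms]
  have "m \<in> (+) (xy_exponent n n) ` cylindric_exponents n n \<longleftrightarrow>
      Poly_Mapping.lookup m (Inl n) > 0 \<and> Poly_Mapping.lookup m (Inr n) > 0"
    if m: "m \<in> cylindric_exponents n n" for m
  proof
    assume "Poly_Mapping.lookup m (Inl n) > 0 \<and> Poly_Mapping.lookup m (Inr n) > 0"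
    then show "m \<in> (+) (xy_exponent n n) ` cylindric_exponents n n"
      using anti[OF m] by (intro cylindric_diff_xy_exponent[OF m]) (auto intro: less_le_trans)
  qed (use assms in \<open>auto simp: lookup_add\<close>)
  then show ?both
    unfolding less set_eq_iff Diff_iff Un_iff mem_Collect_eq neq0_conv[symmetric] by blast
  have "m \<in> (+) (xy_exponent n (n - 1)) ` cylindric_exponents n (n - 1) \<longleftrightarrow>
      Poly_Mapping.lookup m (Inl n) > 0"
    if m: "m \<in> cylindric_exponents n (n - 1)" for m
  proof
    assume "Poly_Mapping.lookup m (Inl n) > 0"
    then show "m \<in> (+) (xy_exponent n (n - 1)) ` cylindric_exponents n (n - 1)"
      using anti(1)[OF m] strict(1)[OF m]
      by (intro cylindric_diff_xy_exponent[OF m]) (auto intro: less_le_trans)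
  qed (use assms in \<open>auto simp: lookup_add\<close>)
  then show ?left
    unfolding less(1)[of "n - 1"] set_eq_iff Diff_iff mem_Collect_eq neq0_conv[symmetric] by blast
  have "m \<in> (+) (xy_exponent (n - 1) n) ` cylindric_exponents (n - 1) n \<longleftrightarrow>
      Poly_Mapping.lookup m (Inr n) > 0"
    if m: "m \<in> cylindric_exponents (n - 1) n" for m
  proof
    assume "Poly_Mapping.lookup m (Inr n) > 0"
    then show "m \<in> (+) (xy_exponent (n - 1) n) ` cylindric_exponents (n - 1) n"
      using anti(2)[OF m] strict(2)[OF m]
      by (intro cylindric_diff_xy_exponent[OF m]) (auto intro: less_le_trans)
  qed (use assms in \<open>auto simp: lookup_add\<close>)
  then show ?right
    unfolding less(2)[of "n - 1"] set_eq_iff Diff_iff mem_Collect_eq neq0_conv[symmetric] by blast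
qed

text \<open>A pair of rows can be read off from its monomial, so each exponent is hit at most once
  and all coefficients are 0 or 1.\<close>

lemma CP11_eq_indicator: "CP11 n = mfps_indicator (cylindric_exponents n n)"
proof (rule mfps_eqI)
  fix m :: "nat + nat \<Rightarrow>\<^sub>0 nat"
  let ?f = "\<lambda>(a, b). \<Prod>i=1..n. xvar i ^ a i * yvar i ^ b i :: (nat + nat, 'a) mfps"
  let ?e = "\<lambda>a b. \<Sum>i=1..n. Poly_Mapping.single (Inl i :: nat + nat) (a i :: nat) +
    Poly_Mapping.single (Inr i) (b i)"
  let ?w = "(\<lambda>l. Poly_Mapping.lookup m (Inl l), \<lambda>l. Poly_Mapping.lookup m (Inr l))"
  have f: "?f (a, b) = mfps_monom (?e a b)" for a b
    by (simp add: xvar_def yvar_def mfps_var_power mfps_monom_mult mfps_monom_prod)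
  \<comment> \<open>Rows in \<open>cylindric11 n\<close> vanish outside 1..n, index 0 included, so
    the equality can be tested at every variable although the product involves only the indices
    1..n.\<close>
  have e: "m = ?e a b \<longleftrightarrow> (a, b) = ?w" if "(a, b) \<in> cylindric11 n" for a b
  proof -
    have "Poly_Mapping.lookup (?e a b) (Inl l) = a l" "Poly_Mapping.lookup (?e a b) (Inr l) = b l" for l
      using that
      by (auto simp: cylindric11_def lookup_sum lookup_add lookup_single when_def)
    then have "m = ?e a b \<longleftrightarrow> (\<forall>l. Poly_Mapping.lookup m (Inl l) = a l \<and> Poly_Mapping.lookup m (Inr l) = b l)"
      by (simp add: poly_mapping_eq_iff fun_eq_iff all_conj_distrib split_sum_all)
    then show ?thesis
      by (auto simp: fun_eq_iff)
  qed
  have w: "?w \<in> cylindric11 n \<longleftrightarrow> m \<in> cylindric_exponents n n"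
    by (auto simp: cylindric11_def cylindric_exponents_def interlacing_def)
  have coeff: "mcoeff (?f u) m = (if u = ?w then 1 else 0)" if "u \<in> cylindric11 n" for u
    using that f e by (cases u) (simp add: mfps_monom_def)
  then have "{u. u \<in> cylindric11 n \<and> mcoeff (?f u) m \<noteq> 0} = {u. u \<in> cylindric11 n \<and> u = ?w}"
    by (intro Collect_cong conj_cong) simp_all
  also have "\<dots> = (if ?w \<in> cylindric11 n then {?w} else {})"
    by auto
  finally have "mcoeff (CP11 n) m = (\<Sum>u \<in> (if ?w \<in> cylindric11 n then {?w} else {}). mcoeff (?f u) m)"
    by (simp add: CP11_def mfps_suminf_def)
  also have "\<dots> = (if ?w \<in> cylindric11 n then 1 else 0)"
    using coeff[of ?w] by simp
  finally show "mcoeff (CP11 n) m = mcoeff (mfps_indicator (cylindric_exponents n n) :: (nat + nat, 'a) mfps) m"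
    unfolding w by (simp add: mcoeff_indicator)
qed

section \<open>Elimination of the mixed generating functions\<close>

theorem theorem3p1:
  fixes n :: nat
  assumes "n > 1"
  shows "(CP11 n :: (nat + nat, 'a :: comm_ring_1) mfps) =
    (1 - Xprod (n - 1) * Xprod n * Yprod (n - 1) * Yprod n) /
    ((1 - Xprod n * Yprod (n - 1)) * (1 - Xprod (n - 1) * Yprod n) * (1 - Xprod n * Yprod n)) *
    CP11 (n - 1)"
proof (rule mfps_divide_eqI)
  define A B C :: "(nat + nat, 'a) mfps"
    where "A = Xprod n * Yprod (n - 1)" and "B = Xprod (n - 1) * Yprod n" and "C = Xprod n * Yprod n"
  define L R P :: "(nat + nat, 'a) mfps"
    where "L = mfps_indicator (cylindric_exponents n (n - 1))"
      and "R = mfps_indicator (cylindric_exponents (n - 1) n)"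
      and "P = CP11 (n - 1)"
  have n: "n > 0"
    using assms by simp
  note shift = one_minus_monom_mult_indicator[OF image_subsetI[OF xy_exponent_add_cylindric]]
  \<comment> \<open>The overlap is counted in both \<open>L\<close> and \<open>R\<close>;
    inclusion-exclusion removes it once, giving the term \<open>- P\<close>.\<close>
  have "cylindric_exponents n (n - 1) \<inter> cylindric_exponents (n - 1) n =
      cylindric_exponents (n - 1) (n - 1)"
    unfolding cylindric_exponents_def by auto
  then have "mfps_indicator (cylindric_exponents n (n - 1) \<union> cylindric_exponents (n - 1) n) = L + R - P"
    using mfps_indicator_Un_Int[of "cylindric_exponents n (n - 1)" "cylindric_exponents (n - 1) n"]
    unfolding L_def R_def P_def CP11_eq_indicator by (simp add: eq_diff_eq)
  then have C: "(1 - C) * CP11 n = L + R - P"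
    unfolding C_def CP11_eq_indicator Xprod_mult_Yprod
    by (simp add: shift cylindric_exponents_unshifted(1)[OF n])
  have A: "(1 - A) * L = P"
    unfolding A_def L_def P_def CP11_eq_indicator Xprod_mult_Yprod
    by (subst shift) (simp_all add: cylindric_exponents_unshifted(2)[OF n, simplified])
  have B: "(1 - B) * R = P"
    unfolding B_def R_def P_def CP11_eq_indicator Xprod_mult_Yprod
    by (subst shift) (simp_all add: cylindric_exponents_unshifted(3)[OF n, simplified])
  have "(1 - A) * (1 - B) * (1 - C) * CP11 n =
      (1 - B) * ((1 - A) * L) + (1 - A) * ((1 - B) * R) - (1 - A) * (1 - B) * P"
    by (simp only: mult.assoc C) (simp only: algebra_simps)
  \<comment> \<open>The factor of \<open>P\<close> is (1 - B) + (1 - A) - (1 - A)(1 - B) = 1 - AB,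
    the source of the numerator.\<close>
  also have "\<dots> = (1 - A * B) * P"
    unfolding A B by (simp add: algebra_simps)
  also have "A * B = Xprod (n - 1) * Xprod n * Yprod (n - 1) * Yprod n"
    by (simp only: A_def B_def mult_ac)
  finally show "(1 - Xprod n * Yprod (n - 1)) * (1 - Xprod (n - 1) * Yprod n) *
      (1 - Xprod n * Yprod n) * (CP11 n :: (nat + nat, 'a) mfps) =
    (1 - Xprod (n - 1) * Xprod n * Yprod (n - 1) * Yprod n) * CP11 (n - 1)"
    unfolding A_def B_def C_def P_def .
next
  let ?d = "(1 - Xprod n * Yprod (n - 1)) * (1 - Xprod (n - 1) * Yprod n) *
    (1 - Xprod n * Yprod n) :: (nat + nat, 'a) mfps"
  \<comment> \<open>Each of the three index pairs has a positive member, so no monomial is constant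
    and each factor is a unit.\<close>
  show "?d * inverse ?d = 1"
    unfolding Xprod_mult_Yprod using assms
    by (intro mfps_mult_inverse mfps_inverse_one_minus_monom xy_exponent_nonzero) auto
qed

end
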